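(* Let $M$ be a finite set of prime numbers, let $p$ be a prime with $p\notin M$, and let $a$ be any $M$-prime. Then $p$ divides one and only one of the $M$-primes in the series $$K\cdot\prod_{p_i\in M}p_i + a,\qquad 0\le K\le p-1 .$$
   Context: For a set $M$ of prime numbers, an $M$-prime is an integer not divisible by any of the primes in $M$. $K$ ranges over integers. *)

theory Defs
  imports "HOL-Computational_Algebra.Primes"
begin

(* Primes are taken in int, where the library's "prime" entails positivity.
   An M_prime need not be prime: it may be 1, negative or composite
   (and for M = {} every integer, including 0, qualifies). *)
definition M_prime :: "int set \<Rightarrow> int \<Rightarrow> bool" where
  "M_prime M n \<longleftrightarrow> (\<forall>q\<in>M. \<not> q dvd n)"

end

theory Submission
  imports Defs "HOL-Number_Theory.Cong"
begin

text \<open>Let P be the product of \<open>M\<close>. Each prime in \<open>M\<close> divides K * P,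
  so every term K * P + a inherits from \<open>a\<close> the property of being an
  \<open>M\<close>-prime (\<open>M_prime_mult_prod_add_iff\<close>). Since P is coprime to
  \<open>p\<close>, the map K \<mapsto> K * P + a permutes the residues modulo \<open>p\<close>,
  hence takes the value 0 for exactly one K in the range
  (\<open>ex1_residue_dvd_linear\<close>).\<close>

lemma M_prime_mult_prod_add_iff:
  assumes "finite M"
  shows "M_prime M (K * (\<Prod>q\<in>M. q) + a) \<longleftrightarrow> M_prime M a"
proof -
  have "q dvd K * (\<Prod>q\<in>M. q)" if "q \<in> M" for q
    using dvd_prodI[OF assms that, of "\<lambda>q. q"] by simp
  then show ?thesis
    by (simp add: M_prime_def dvd_add_right_iff)
qed

text \<open>\<open>P\<close> is invertible modulo \<open>p\<close>, so the divisibility fixes the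
  residue class of \<open>K\<close>, and a class has one representative from 0 to
  \<open>p - 1\<close>.\<close>

lemma ex1_residue_dvd_linear:
  fixes P p a :: int
  assumes "coprime P p" and "p > 0"
  shows "\<exists>!K. 0 \<le> K \<and> K < p \<and> p dvd K * P + a"
proof -
  obtain x where x: "[P * x = 1] (mod p)"
    using cong_solve_coprime_int[OF assms(1)] by blast
  show ?thesis
  \<comment> \<open>As \<open>x\<close> inverts \<open>P\<close> modulo \<open>p\<close>, this is
    the solution of K * P \<equiv> -a, reduced into the required range.\<close>
  proof (rule ex1I[of _ "(- a * x) mod p"])
    have "[(- a * x) mod p * P + a = - a * x * P + a] (mod p)"
      by (intro cong_add cong_mult cong_refl) (simp add: cong_def)
    also have "- a * x * P + a = - a * (P * x) + a"
      by simp
    also have "[- a * (P * x) + a = - a * 1 + a] (mod p)"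
      by (intro cong_add cong_mult cong_refl x)
    finally show "0 \<le> (- a * x) mod p \<and> (- a * x) mod p < p \<and> p dvd (- a * x) mod p * P + a"
      using \<open>p > 0\<close> by (simp add: cong_0_iff)
  next
    fix K assume K: "0 \<le> K \<and> K < p \<and> p dvd K * P + a"
    then have "[K * P = - a] (mod p)"
      by (simp add: cong_iff_dvd_diff)
    \<comment> \<open>Multiplying by the inverse \<open>x\<close> cancels \<open>P\<close> and
      isolates \<open>K\<close>.\<close>
    then have "[K * P * x = - a * x] (mod p)"
      by (rule cong_mult) simp
    moreover have "[K * (P * x) = K * 1] (mod p)"
      by (intro cong_mult cong_refl x)
    ultimately have "[K = - a * x] (mod p)"
      by (metis cong_sym cong_trans mult.assoc mult.right_neutral)
    then show "K = (- a * x) mod p"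
      using K by (simp add: cong_def)
  qed
qed

theorem mainTheorem12:
  fixes M :: "int set" and p a :: int
  assumes "finite M" and "\<forall>q\<in>M. prime q"
    and "prime p" and "p \<notin> M"
    and "M_prime M a"
  shows "\<exists>!K::int. 0 \<le> K \<and> K \<le> p - 1
           \<and> M_prime M (K * (\<Prod>q\<in>M. q) + a) \<and> p dvd K * (\<Prod>q\<in>M. q) + a"
proof -
  \<comment> \<open>Since \<open>p \<notin> M\<close>, each factor is a prime different from
    \<open>p\<close>.\<close>
  have "coprime (\<Prod>q\<in>M. q) p"
    using assms by (intro prod_coprime_left primes_coprime) auto
  then show ?thesis
    using ex1_residue_dvd_linear[of "\<Prod>q\<in>M. q" p a] assms
    by (simp add: M_prime_mult_prod_add_iff prime_gt_0_int)
qed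

end
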